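(* Let $C(n)$ be the number of basic operations used by the algorithm described in the context to recognize whether the input integer $n>3$ is prime or composite. Then $C(n)\in O(n^2)$.
   Context: Each integer arithmetic operation and each comparison counts as one basic operation. Loops "for $x=a$ to $b$" are empty if $b<a$. The algorithm, on input an integer $n>3$, is: Step 1. If $n+1\equiv 0 \pmod 6$, set $k=(n+1)/6$, $r_{\max}=\lfloor (k-6)/5\rfloor$, $s_{\max}=\lfloor (k-6)/7\rfloor$. For $s=0$ to $s_{\max}$ and for $r=0$ to $r_{\max}$, compute $k(r,s)=6+7s+(5+6s)r$; if $k(r,s)=k$, output COMPOSITE and stop. If no equality is found, output PRIME. Step 2. If $n-1\equiv 0\pmod 6$, set $k=(n-1)/6$, $l_{\max}=\lfloor (k-4)/5\rfloor$, $m_{\max}=l_{\max}+1$. For $m=0$ to $m_{\max}$ and for $l=m$ to $l_{\max}$, compute $k(l,m)=4+5m+(5+6m)l$; if $k(l,m)=k$, output COMPOSITE and stop. Otherwise, set $c_{\max}=\lfloor (k-8)/7\rfloor$, $d_{\max}=c_{\max}+1$. For $d=0$ to $d_{\max}$ and for $c=d$ to $c_{\max}$, compute $k(c,d)=8+7d+(7+6d)c$; if $k(c,d)=k$, output COMPOSITE and stop. If no equality is found, output PRIME. Step 3. In all other cases, output COMPOSITE. *)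

theory Defs
  imports Complex_Main "HOL-Library.Landau_Symbols"
begin

text \<open>
  The algorithm is written as a program of a small imperative language whose interpreter counts
  basic operations, so that every operation occurring in the program text is charged.
\<close>

datatype var =
    v_n | v_k | v_val
  | v_r_max | v_s_max | v_r | v_s
  | v_l_max | v_m_max | v_l | v_m
  | v_c_max | v_d_max | v_c | v_d

type_synonym state = "var \<Rightarrow> int"

datatype aexp =
    Num int
  | Var var
  | Add aexp aexp (infixl "\<oplus>" 65)
  | Sub aexp aexp (infixl "\<ominus>" 65)
  | Mul aexp aexp (infixl "\<otimes>" 70)
  | Div aexp aexp (infixl "DIV" 70)
  | Mod aexp aexp (infixl "MOD" 70)

text \<open>\<open>Div\<close> is division rounded towards minus infinity, i.e. the floor of the quotient,
  including negative dividends.\<close>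

primrec aval :: "aexp \<Rightarrow> state \<Rightarrow> int" where
  "aval (Num i) \<sigma> = i"
| "aval (Var x) \<sigma> = \<sigma> x"
| "aval (a \<oplus> b) \<sigma> = aval a \<sigma> + aval b \<sigma>"
| "aval (a \<ominus> b) \<sigma> = aval a \<sigma> - aval b \<sigma>"
| "aval (a \<otimes> b) \<sigma> = aval a \<sigma> * aval b \<sigma>"
| "aval (a DIV b) \<sigma> = aval a \<sigma> div aval b \<sigma>"
| "aval (a MOD b) \<sigma> = aval a \<sigma> mod aval b \<sigma>"

primrec aops :: "aexp \<Rightarrow> nat" where
  "aops (Num i) = 0"
| "aops (Var x) = 0"
| "aops (a \<oplus> b) = aops a + aops b + 1"
| "aops (a \<ominus> b) = aops a + aops b + 1"
| "aops (a \<otimes> b) = aops a + aops b + 1"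
| "aops (a DIV b) = aops a + aops b + 1"
| "aops (a MOD b) = aops a + aops b + 1"

datatype verdict = PRIME | COMPOSITE

datatype com =
    Skip
  | Assign var aexp ("_ ::= _" [1000, 61] 61)
  | Seq com com (infixr ";;" 60)
  | IfEq aexp aexp com com ("(IF _ \<doteq> _/ THEN _/ ELSE _)" [62, 62, 0, 61] 61)
  | For var aexp aexp com ("(FOR _ FROM _ TO _/ DO _)" [1000, 62, 62, 61] 61)
  | Output verdict

text \<open>
  A run yields the final state, the verdict if the program has output one (which stops the
  program), and the number of basic operations performed.
\<close>

type_synonym result = "state \<times> verdict option \<times> nat"

text \<open>
  The loop control is charged as well: one comparison for each test of the loop variable against
  the upper bound (including the final, failing one) and one addition for each increment.
\<close>

function loop :: "(state \<Rightarrow> result) \<Rightarrow> var \<Rightarrow> int \<Rightarrow> int \<Rightarrow> state \<Rightarrow> result" where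
  "loop body x i b \<sigma> =
     (if i \<le> b
      then (case body (\<sigma>(x := i)) of
              (\<sigma>', Some v, t) \<Rightarrow> (\<sigma>', Some v, 1 + t)
            | (\<sigma>', None, t) \<Rightarrow>
                (case loop body x (i + 1) b \<sigma>' of (\<sigma>'', w, u) \<Rightarrow> (\<sigma>'', w, 1 + t + 1 + u)))
      else (\<sigma>, None, 1))"
  by pat_completeness auto
termination
  by (relation "measure (\<lambda>(body, x, i, b, \<sigma>). nat (b + 1 - i))") auto

declare loop.simps [simp del]

primrec exec :: "com \<Rightarrow> state \<Rightarrow> result" where
  "exec Skip \<sigma> = (\<sigma>, None, 0)"
| "exec (x ::= a) \<sigma> = (\<sigma>(x := aval a \<sigma>), None, aops a)"
| "exec (c ;; d) \<sigma> =
     (case exec c \<sigma> of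
        (\<sigma>', Some v, t) \<Rightarrow> (\<sigma>', Some v, t)
      | (\<sigma>', None, t) \<Rightarrow> (case exec d \<sigma>' of (\<sigma>'', w, u) \<Rightarrow> (\<sigma>'', w, t + u)))"
| "exec (IF a \<doteq> b THEN c ELSE d) \<sigma> =
     (case (if aval a \<sigma> = aval b \<sigma> then exec c \<sigma> else exec d \<sigma>) of
        (\<sigma>', w, t) \<Rightarrow> (\<sigma>', w, aops a + aops b + 1 + t))"
| "exec (FOR x FROM a TO b DO c) \<sigma> =
     (case loop (exec c) x (aval a \<sigma>) (aval b \<sigma>) \<sigma> of
        (\<sigma>', w, t) \<Rightarrow> (\<sigma>', w, aops a + aops b + t))"
| "exec (Output v) \<sigma> = (\<sigma>, Some v, 0)"

definition check_value :: "aexp \<Rightarrow> com" where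
  "check_value a =
     (v_val ::= a ;;
      IF Var v_val \<doteq> Var v_k THEN Output COMPOSITE ELSE Skip)"

definition step1 :: com where
  "step1 =
     (IF (Var v_n \<oplus> Num 1) MOD Num 6 \<doteq> Num 0 THEN
        v_k ::= (Var v_n \<oplus> Num 1) DIV Num 6 ;;
        v_r_max ::= (Var v_k \<ominus> Num 6) DIV Num 5 ;;
        v_s_max ::= (Var v_k \<ominus> Num 6) DIV Num 7 ;;
        FOR v_s FROM Num 0 TO Var v_s_max DO
          FOR v_r FROM Num 0 TO Var v_r_max DO
            check_value
              (Num 6 \<oplus> Num 7 \<otimes> Var v_s \<oplus> (Num 5 \<oplus> Num 6 \<otimes> Var v_s) \<otimes> Var v_r) ;;
        Output PRIME
      ELSE Skip)"

definition step2 :: com where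
  "step2 =
     (IF (Var v_n \<ominus> Num 1) MOD Num 6 \<doteq> Num 0 THEN
        v_k ::= (Var v_n \<ominus> Num 1) DIV Num 6 ;;
        v_l_max ::= (Var v_k \<ominus> Num 4) DIV Num 5 ;;
        v_m_max ::= Var v_l_max \<oplus> Num 1 ;;
        FOR v_m FROM Num 0 TO Var v_m_max DO
          FOR v_l FROM Var v_m TO Var v_l_max DO
            check_value
              (Num 4 \<oplus> Num 5 \<otimes> Var v_m \<oplus> (Num 5 \<oplus> Num 6 \<otimes> Var v_m) \<otimes> Var v_l) ;;
        v_c_max ::= (Var v_k \<ominus> Num 8) DIV Num 7 ;;
        v_d_max ::= Var v_c_max \<oplus> Num 1 ;;
        FOR v_d FROM Num 0 TO Var v_d_max DO
          FOR v_c FROM Var v_d TO Var v_c_max DO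
            check_value
              (Num 8 \<oplus> Num 7 \<otimes> Var v_d \<oplus> (Num 7 \<oplus> Num 6 \<otimes> Var v_d) \<otimes> Var v_c) ;;
        Output PRIME
      ELSE Skip)"

definition step3 :: com where
  "step3 = Output COMPOSITE"

definition algorithm :: com where
  "algorithm = step1 ;; step2 ;; step3"

definition run :: "int \<Rightarrow> result" where
  "run n = exec algorithm ((\<lambda>_. 0)(v_n := n))"

definition verdict_of :: "int \<Rightarrow> verdict option" where
  "verdict_of n = fst (snd (run n))"

definition C :: "int \<Rightarrow> nat" where
  "C n = snd (snd (run n))"

end

theory Submission imports Defs begin

text \<open>
  The input enters the running time only through the loop bounds. All six of them are at most
  \<open>n + 1\<close> and all counters start at a nonnegative value, so each loop makes at most \<open>n + 2\<close>
  iterations. Loops are nested at most two deep, the innermost body is a single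
  \<^const>\<open>check_value\<close>, which costs seven operations plus two of loop control, and there are three
  such nests, run one after the other. The total is therefore at most \<open>27 (n + 2)\<^sup>2\<close> up to terms of
  lower order (\<open>C_le\<close>); stopping early only makes it smaller.

  The formal argument is a Hoare-style cost calculus (\<open>runs_within\<close>) with one state predicate that
  serves as precondition, postcondition and loop invariant alike. For the algorithm it is
  \<open>bounds_linear\<close>, which says that every loop bound is at most \<open>n + 1\<close> and that the inner loops
  of Step 2 start at a nonnegative value. Every single assignment of the program preserves it,
  because the bounds are computed only from \<open>v_n\<close>, \<open>v_k\<close>, \<open>v_l_max\<close> and \<open>v_c_max\<close>, whose sizes
  it controls as well.
\<close>

section \<open>A cost calculus with a fixed invariant\<close>

text \<open>
  The predicate is demanded of the final state even when the run was stopped by an output. This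
  keeps the verdict out of the rules below.
\<close>

definition runs_within :: "(state \<Rightarrow> bool) \<Rightarrow> com \<Rightarrow> nat \<Rightarrow> bool" where
  "runs_within P c t \<longleftrightarrow>
     (\<forall>\<sigma>. P \<sigma> \<longrightarrow> P (fst (exec c \<sigma>)) \<and> snd (snd (exec c \<sigma>)) \<le> t)"

lemma runs_within_Skip: "runs_within P Skip 0"
  by (simp add: runs_within_def)

lemma runs_within_Output: "runs_within P (Output v) 0"
  by (simp add: runs_within_def)

lemma runs_within_mono:
  assumes "runs_within P c s" "s \<le> t"
  shows "runs_within P c t"
  using assms by (force simp: runs_within_def)

lemma runs_within_Assign:
  assumes "\<And>\<sigma>. P \<sigma> \<Longrightarrow> P (\<sigma>(x := aval a \<sigma>))"
  shows "runs_within P (x ::= a) (aops a)"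
  using assms by (simp add: runs_within_def)

lemma runs_within_Seq:
  assumes "runs_within P c s" "runs_within P d t"
  shows "runs_within P (c ;; d) (s + t)"
  unfolding runs_within_def
proof (intro allI impI)
  fix \<sigma> assume "P \<sigma>"
  obtain \<sigma>' w u where c: "exec c \<sigma> = (\<sigma>', w, u)"
    by (metis prod_cases3)
  obtain \<sigma>'' w' u' where d: "exec d \<sigma>' = (\<sigma>'', w', u')"
    by (metis prod_cases3)
  have "P \<sigma>'" "u \<le> s"
    using assms(1) \<open>P \<sigma>\<close> c by (force simp: runs_within_def)+
  moreover from this have "P \<sigma>''" "u' \<le> t"
    using assms(2) d by (force simp: runs_within_def)+
  ultimately show "P (fst (exec (c ;; d) \<sigma>)) \<and> snd (snd (exec (c ;; d) \<sigma>)) \<le> s + t"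
    using c d by (simp split: option.split)
qed

lemma runs_within_IfEq:
  assumes "runs_within P c s" "runs_within P d t"
  shows "runs_within P (IF a \<doteq> b THEN c ELSE d) (aops a + aops b + 1 + max s t)"
  using assms unfolding runs_within_def
  by (auto simp: split_beta le_max_iff_disj)

text \<open>
  Each iteration is charged the body, one comparison and one increment; the summand \<open>1\<close> is the
  final, failing comparison. The body runs with its counter already set, so the invariant has to
  survive that update as well.
\<close>

lemma loop_cost:
  assumes body: "\<And>\<sigma>. P \<sigma> \<Longrightarrow> P (fst (body \<sigma>)) \<and> snd (snd (body \<sigma>)) \<le> t"
    and counter: "\<And>\<sigma> j. P \<sigma> \<Longrightarrow> i \<le> j \<Longrightarrow> P (\<sigma>(x := j))"
    and "P \<sigma>"
  shows "P (fst (loop body x i b \<sigma>)) \<and>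
         snd (snd (loop body x i b \<sigma>)) \<le> nat (b + 1 - i) * (t + 2) + 1"
  using assms(2,3)
proof (induction "nat (b + 1 - i)" arbitrary: i \<sigma>)
  case 0
  then show ?case by (subst (1 2) loop.simps) simp
next
  case (Suc m)
  have "i \<le> b" using Suc.hyps(2) by linarith
  obtain \<sigma>' w u where now: "body (\<sigma>(x := i)) = (\<sigma>', w, u)"
    by (metis prod_cases3)
  obtain \<sigma>'' w' u' where rest: "loop body x (i + 1) b \<sigma>' = (\<sigma>'', w', u')"
    by (metis prod_cases3)
  have "P (\<sigma>(x := i))" using Suc.prems by simp
  then have "P \<sigma>'" and u: "u \<le> t" using body now by force+
  have m: "m = nat (b + 1 - (i + 1))" using Suc.hyps(2) by linarith
  have "P \<sigma>''" and u': "u' \<le> m * (t + 2) + 1"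
    using Suc.hyps(1)[OF m _ \<open>P \<sigma>'\<close>] Suc.prems(1) rest m by force+
  moreover have "1 + u + 1 + u' \<le> Suc m * (t + 2) + 1"
    using u u' by simp
  ultimately show ?case
    using \<open>i \<le> b\<close> now rest \<open>P \<sigma>'\<close> u
    by (subst (1 2) loop.simps) (simp add: Suc.hyps(2)[symmetric] split: option.split)
qed

lemma runs_within_For:
  assumes body: "runs_within P c t"
    and range: "\<And>\<sigma>. P \<sigma> \<Longrightarrow> aval b \<sigma> + 1 - aval a \<sigma> \<le> int N"
    and start: "\<And>\<sigma>. P \<sigma> \<Longrightarrow> 0 \<le> aval a \<sigma>"
    and counter: "\<And>\<sigma> j. P \<sigma> \<Longrightarrow> 0 \<le> j \<Longrightarrow> P (\<sigma>(x := j))"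
  shows "runs_within P (FOR x FROM a TO b DO c) (aops a + aops b + N * (t + 2) + 1)"
  unfolding runs_within_def
proof (intro allI impI)
  fix \<sigma> assume "P \<sigma>"
  let ?r = "loop (exec c) x (aval a \<sigma>) (aval b \<sigma>) \<sigma>"
  have "P (fst ?r) \<and> snd (snd ?r) \<le> nat (aval b \<sigma> + 1 - aval a \<sigma>) * (t + 2) + 1"
    using body start[OF \<open>P \<sigma>\<close>] counter \<open>P \<sigma>\<close>
    by (intro loop_cost) (auto simp: runs_within_def simp del: fun_upd_apply)
  moreover have "nat (aval b \<sigma> + 1 - aval a \<sigma>) * (t + 2) \<le> N * (t + 2)"
    using range[OF \<open>P \<sigma>\<close>] by (intro mult_le_mono1) linarith
  ultimately show "P (fst (exec (FOR x FROM a TO b DO c) \<sigma>)) \<and>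
      snd (snd (exec (FOR x FROM a TO b DO c) \<sigma>)) \<le> aops a + aops b + N * (t + 2) + 1"
    by (simp add: split_beta)
qed

section \<open>The running time of the algorithm\<close>

text \<open>
  \<open>v_m_max\<close> and \<open>v_d_max\<close> exceed \<open>v_l_max\<close> and \<open>v_c_max\<close> by one; they get the weaker bound
  \<open>n + 1\<close> so that every assignment preserves the predicate by itself.
\<close>

definition bounds_linear :: "int \<Rightarrow> state \<Rightarrow> bool" where
  "bounds_linear n \<sigma> \<longleftrightarrow>
     \<sigma> v_n = n \<and> \<sigma> v_k \<le> n \<and> \<sigma> v_r_max \<le> n \<and> \<sigma> v_s_max \<le> n \<and>
     \<sigma> v_l_max \<le> n \<and> \<sigma> v_c_max \<le> n \<and> \<sigma> v_m_max \<le> n + 1 \<and> \<sigma> v_d_max \<le> n + 1 \<and>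
     0 \<le> \<sigma> v_m \<and> 0 \<le> \<sigma> v_d"

lemma check_value_cost:
  "runs_within (bounds_linear n) (check_value a) (aops a + 1)"
proof -
  have "runs_within (bounds_linear n) (v_val ::= a) (aops a)"
    by (rule runs_within_Assign) (simp add: bounds_linear_def)
  from runs_within_Seq[OF this runs_within_IfEq[OF runs_within_Output runs_within_Skip,
        of _ "Var v_val" "Var v_k" COMPOSITE]]
  show ?thesis by (simp add: check_value_def)
qed

text \<open>
  Step 1 and both parts of Step 2 search for \<open>v_k\<close> with a nest of this form. The constant \<open>9\<close> is
  made up of six operations for the candidate value, its comparison with \<open>v_k\<close>, and two
  operations of loop control.
\<close>

lemma search_cost:
  assumes "n > 0"
    and counters: "\<And>\<sigma> j. bounds_linear n \<sigma> \<Longrightarrow> 0 \<le> j \<Longrightarrow> bounds_linear n (\<sigma>(x := j))"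
      "\<And>\<sigma> j. bounds_linear n \<sigma> \<Longrightarrow> 0 \<le> j \<Longrightarrow> bounds_linear n (\<sigma>(y := j))"
    and outer: "\<And>\<sigma>. bounds_linear n \<sigma> \<Longrightarrow> \<sigma> y_max \<le> n + 1"
    and inner: "\<And>\<sigma>. bounds_linear n \<sigma> \<Longrightarrow> \<sigma> x_max \<le> n + 1"
    and start: "\<And>\<sigma>. bounds_linear n \<sigma> \<Longrightarrow> 0 \<le> aval a \<sigma>"
    and ops: "aops a = 0" "aops e = 6"
  shows "runs_within (bounds_linear n)
    (FOR y FROM Num 0 TO Var y_max DO FOR x FROM a TO Var x_max DO check_value e)
    (nat (n + 2) * (nat (n + 2) * 9 + 3) + 1)"
proof -
  have "runs_within (bounds_linear n) (FOR x FROM a TO Var x_max DO check_value e)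
      (aops a + aops (Var x_max) + nat (n + 2) * (aops e + 1 + 2) + 1)"
  proof (rule runs_within_For[OF check_value_cost])
    show "aval (Var x_max) \<sigma> + 1 - aval a \<sigma> \<le> int (nat (n + 2))" if "bounds_linear n \<sigma>" for \<sigma>
      using inner[OF that] start[OF that] \<open>n > 0\<close> by simp
  qed (fact start counters)+
  then have "runs_within (bounds_linear n) (FOR x FROM a TO Var x_max DO check_value e)
      (nat (n + 2) * 9 + 1)"
    by (simp add: ops)
  then have "runs_within (bounds_linear n)
    (FOR y FROM Num 0 TO Var y_max DO FOR x FROM a TO Var x_max DO check_value e)
    (aops (Num 0) + aops (Var y_max) + nat (n + 2) * (nat (n + 2) * 9 + 1 + 2) + 1)"
  proof (rule runs_within_For)
    show "aval (Var y_max) \<sigma> + 1 - aval (Num 0) \<sigma> \<le> int (nat (n + 2))"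
      if "bounds_linear n \<sigma>" for \<sigma>
      using outer[OF that] \<open>n > 0\<close> by simp
  qed (simp, fact counters)
  then show ?thesis by (simp add: algebra_simps)
qed

text \<open>This bounds each computed quotient by a linear inequality about its dividend.\<close>

lemma div_le_if_le_mult:
  fixes x y d :: int
  assumes "x \<le> d * y" "0 < d"
  shows "x div d \<le> y"
  using zdiv_mono1[OF assms] assms(2) by simp

text \<open>
  The summands \<open>9\<close> and \<open>11\<close> in the next two bounds count the operations outside the searches:
  the congruence test and the computation of \<open>v_k\<close> and of the loop bounds.
\<close>

lemma step1_cost:
  assumes "n > 0"
  shows "runs_within (bounds_linear n) step1 ((nat (n + 2) * (nat (n + 2) * 9 + 3) + 1) + 9)"
  unfolding step1_def
  by (rule runs_within_mono,
      (rule runs_within_IfEq runs_within_Seq runs_within_Assign runs_within_Output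
         runs_within_Skip search_cost[OF assms]
       | use assms in \<open>simp add: bounds_linear_def div_le_if_le_mult\<close>)+)

lemma step2_cost:
  assumes "n > 0"
  shows "runs_within (bounds_linear n) step2
           (2 * (nat (n + 2) * (nat (n + 2) * 9 + 3) + 1) + 11)"
  unfolding step2_def
  by (rule runs_within_mono,
      (rule runs_within_IfEq runs_within_Seq runs_within_Assign runs_within_Output
         runs_within_Skip search_cost[OF assms]
       | use assms in \<open>simp add: bounds_linear_def div_le_if_le_mult\<close>)+)

lemma C_le:
  assumes "n > 0"
  shows "C n \<le> 27 * nat (n + 2) ^ 2 + 9 * nat (n + 2) + 23"
proof -
  have "runs_within (bounds_linear n) algorithm
      (27 * nat (n + 2) ^ 2 + 9 * nat (n + 2) + 23)"
    unfolding algorithm_def step3_def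
    by (rule runs_within_mono[OF runs_within_Seq[OF step1_cost[OF assms]
            runs_within_Seq[OF step2_cost[OF assms] runs_within_Output]]])
       (simp add: power2_eq_square algebra_simps)
  moreover have "bounds_linear n ((\<lambda>_. 0)(v_n := n))"
    using assms by (simp add: bounds_linear_def)
  ultimately show ?thesis
    unfolding runs_within_def C_def run_def by blast
qed

theorem theorem7:
  shows "(\<lambda>n::int. real (C n)) \<in> O(\<lambda>n. real_of_int n ^ 2)"
proof (rule bigoI)
  show "\<forall>\<^sub>F n in at_top. norm (real (C n)) \<le> 293 * norm (real_of_int n ^ 2)"
    using eventually_ge_at_top[of "1::int"]
  proof eventually_elim
    case (elim n)
    have "real (C n) \<le> real (27 * nat (n + 2) ^ 2 + 9 * nat (n + 2) + 23)"
      using C_le[of n] elim by (intro of_nat_mono) simp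
    also have "\<dots> = 27 * (real_of_int n + 2) ^ 2 + 9 * (real_of_int n + 2) + 23"
      using elim by simp
    also have "\<dots> \<le> 293 * real_of_int n ^ 2"
    proof -
      \<comment> \<open>\<open>293\<close> is the sum of the coefficients \<open>27\<close>, \<open>117\<close> and \<open>149\<close> after expansion,
        since both \<open>x\<close> and \<open>1\<close> are at most \<open>x\<^sup>2\<close>.\<close>
      have "27 * (x + 2) ^ 2 + 9 * (x + 2) + 23 \<le> 293 * x ^ 2" if "1 \<le> x" for x :: real
      proof -
        have "x \<le> x ^ 2" using that by (rule self_le_power) simp
        with that show ?thesis by (simp add: power2_sum)
      qed
      then show ?thesis using elim by simp
    qed
    finally show ?case by simp
  qed
qed

end
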